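(* Let $\mathcal V$ be the convex set of all nonnegative real arrays $V=(V_{nk}:\ 0\le k\le n-1,\ n=1,2,\dots)$ satisfying $V_{10}=1$ and $$V_{nk}=(k+1)V_{n+1,k}+(n-k)V_{n+1,k+1}\qquad(0\le k\le n-1,\ n=1,2,\dots).$$ Let $$\Theta=\left\{\tfrac{\varkappa}{2(\varkappa+1)}:\ \varkappa=0,1,\dots\right\}\cup\left\{\tfrac12\right\}\cup\left\{\tfrac{\varkappa+2}{2(\varkappa+1)}:\ \varkappa=0,1,\dots\right\},$$ and for $\theta\in\Theta$ let $W(\theta)=(W_{nk}(\theta))$ denote the unique extreme point $W$ of $\mathcal V$ with $W_{20}=\theta$. Then for all $n=1,2,\dots$ and $0\le k\le n-1$: (i) for $\theta=\frac{\varkappa+2}{2(\varkappa+1)}>\frac12$ with $\varkappa=0,1,2,\dots$, $$W_{nk}(\theta)=\binom{n+\varkappa-k}{n}\Big/(\varkappa+1)^n;$$ (ii) for $\theta=\frac{\varkappa}{2(\varkappa+1)}<\frac12$ with $\varkappa=0,1,2,\dots$, $$W_{nk}(\theta)=\binom{\varkappa+k+1}{n}\Big/(\varkappa+1)^n;$$ (iii) for $\theta=\frac12$, $$W_{nk}(\tfrac12)=\frac1{n!}.$$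
   Context: It is part of the setting that the map $W\mapsto W_{20}$ is a bijection from the set of extreme points of $\mathcal V$ onto $\Theta$, so that $W(\theta)$ is well defined for each $\theta\in\Theta$. Binomial coefficients $\binom{m}{n}$ with $0\le m<n$ are $0$. *)

theory Defs
  imports "HOL-Analysis.Analysis" "HOL-Library.Function_Algebras"
begin

(* Pointwise scalar multiplication, so that the library's notions of convexity and
   extreme point apply to arrays nat \<Rightarrow> nat \<Rightarrow> real. *)
instantiation "fun" :: (type, real_vector) real_vector
begin

definition scaleR_fun :: "real \<Rightarrow> ('a \<Rightarrow> 'b) \<Rightarrow> 'a \<Rightarrow> 'b" where
  "scaleR_fun c f = (\<lambda>x. c *\<^sub>R f x)"

instance
  by standard (simp_all add: scaleR_fun_def fun_eq_iff scaleR_add_right scaleR_add_left)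

end

lemma scaleR_fun_apply [simp]: "(c *\<^sub>R f) x = c *\<^sub>R f x"
  by (simp add: scaleR_fun_def)

(* A triangular array (V_{nk} : n \<ge> 1, 0 \<le> k \<le> n - 1) is represented by the function
   extending it by 0 outside the triangle. Without this normalisation, the irrelevant
   entries would make every point of the set non-extreme and arrays non-unique. *)
definition eulerian_arrays :: "(nat \<Rightarrow> nat \<Rightarrow> real) set" where
  "eulerian_arrays = {V.
     (\<forall>n k. \<not> (1 \<le> n \<and> k < n) \<longrightarrow> V n k = 0) \<and>
     (\<forall>n k. 1 \<le> n \<and> k < n \<longrightarrow> 0 \<le> V n k) \<and>
     V 1 0 = 1 \<and>
     (\<forall>n k. 1 \<le> n \<and> k < n \<longrightarrow>
        V n k = (real k + 1) * V (n + 1) k + (real n - real k) * V (n + 1) (k + 1))}"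

lemma eulerian_arraysD:
  assumes "V \<in> eulerian_arrays"
  shows "\<not> (1 \<le> n \<and> k < n) \<Longrightarrow> V n k = 0"
    and "1 \<le> n \<Longrightarrow> k < n \<Longrightarrow> 0 \<le> V n k"
    and "V 1 0 = 1"
    and "1 \<le> n \<Longrightarrow> k < n \<Longrightarrow>
      V n k = (real k + 1) * V (n + 1) k + (real n - real k) * V (n + 1) (k + 1)"
proof -
  note V = assms[unfolded eulerian_arrays_def mem_Collect_eq]
  note V1 = V[THEN conjunct1, rule_format]
    and V2 = V[THEN conjunct2, THEN conjunct1, rule_format]
    and V3 = V[THEN conjunct2, THEN conjunct2, THEN conjunct1]
    and V4 = V[THEN conjunct2, THEN conjunct2, THEN conjunct2, rule_format]
  show "\<not> (1 \<le> n \<and> k < n) \<Longrightarrow> V n k = 0" by (rule V1)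
  show "1 \<le> n \<Longrightarrow> k < n \<Longrightarrow> 0 \<le> V n k" by (rule V2, rule conjI)
  show "V 1 0 = 1" by (rule V3)
  show "1 \<le> n \<Longrightarrow> k < n \<Longrightarrow>
      V n k = (real k + 1) * V (n + 1) k + (real n - real k) * V (n + 1) (k + 1)"
    by (rule V4, rule conjI)
qed

lemma convex_eulerian_arrays: "convex eulerian_arrays"
proof (rule convexI)
  fix U V :: "nat \<Rightarrow> nat \<Rightarrow> real" and u v :: real
  assume UV: "U \<in> eulerian_arrays" "V \<in> eulerian_arrays"
    and uv: "0 \<le> u" "0 \<le> v" "u + v = 1"
  note U = eulerian_arraysD[OF UV(1)] and V = eulerian_arraysD[OF UV(2)]
  have app: "(u *\<^sub>R U + v *\<^sub>R V) n k = u * U n k + v * V n k" for n k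
    by simp
  show "u *\<^sub>R U + v *\<^sub>R V \<in> eulerian_arrays"
    unfolding eulerian_arrays_def mem_Collect_eq app
  proof (intro conjI allI impI)
    fix n k :: nat
    assume "\<not> (1 \<le> n \<and> k < n)"
    from U(1)[OF this] V(1)[OF this] show "u * U n k + v * V n k = 0"
      by simp
  next
    fix n k :: nat
    assume "1 \<le> n \<and> k < n"
    then have nk: "1 \<le> n" "k < n" by simp_all
    show "0 \<le> u * U n k + v * V n k"
      by (intro add_nonneg_nonneg mult_nonneg_nonneg uv U(2) V(2) nk)
    show "u * U n k + v * V n k
        = (real k + 1) * (u * U (n + 1) k + v * V (n + 1) k)
          + (real n - real k) * (u * U (n + 1) (k + 1) + v * V (n + 1) (k + 1))"
      unfolding U(4)[OF nk] V(4)[OF nk] by (simp only: algebra_simps)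
  next
    show "u * U 1 0 + v * V 1 0 = 1"
      unfolding U(3) V(3) using uv(3) by simp
  qed
qed

definition extreme_arrays :: "(nat \<Rightarrow> nat \<Rightarrow> real) set" where
  "extreme_arrays = {W. W extreme_point_of eulerian_arrays}"

definition Theta :: "real set" where
  "Theta = (range (\<lambda>\<kappa>::nat. real \<kappa> / (2 * (real \<kappa> + 1)))) \<union> {1 / 2} \<union>
           (range (\<lambda>\<kappa>::nat. (real \<kappa> + 2) / (2 * (real \<kappa> + 1))))"

(* Meaningful for \<theta> \<in> Theta, provided that W \<mapsto> W 2 0 is a bijection from
   extreme_arrays onto Theta. *)
definition W_array :: "real \<Rightarrow> nat \<Rightarrow> nat \<Rightarrow> real" where
  "W_array \<theta> = (THE W. W \<in> extreme_arrays \<and> W 2 0 = \<theta>)"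

end

theory Submission
  imports Defs "HOL-Real_Asymp.Real_Asymp"
begin

text \<open>
  By injectivity of \<open>W \<mapsto> W 2 0\<close> on the extreme points, it is enough to check that each explicit
  array lies in the convex set, is extreme there, and has the right entry at \<open>(2, 0)\<close>. Membership
  is an identity between binomial coefficients; the content is extremality.

  An array \<open>W\<close> is extreme once every member \<open>U\<close> of the set that is dominated by a multiple of
  \<open>W\<close> equals \<open>W\<close> (\<open>extreme_arrays_if_dominated_unique\<close>), because the two ends of a segment through
  \<open>W\<close> are so dominated.

  For \<open>\<theta> > 1/2\<close> the array \<open>W\<close> vanishes in all columns \<open>k > \<kappa>\<close>, hence so does \<open>U\<close>. In the last
  nonzero column the recurrence reads \<open>U n \<kappa> = (\<kappa> + 1) * U (n + 1) \<kappa>\<close>, so there \<open>U\<close> is a multiple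
  \<open>c * W\<close> of \<open>W\<close>. The difference \<open>E = U - c * W\<close> then vanishes in column \<open>\<kappa>\<close>. If it vanishes in
  column \<open>j + 1\<close>, then in column \<open>j\<close> it is a multiple of \<open>(j + 1) ^ (-n)\<close>; but it is bounded by a
  multiple of \<open>W\<close>, which decays like a polynomial times \<open>(\<kappa> + 1) ^ (-n)\<close>, so it vanishes in column \<open>j\<close> too. Descending
  through the columns gives \<open>U = c * W\<close>, and \<open>c = 1\<close> by the entry at \<open>(1, 0)\<close>.

  The case \<open>\<theta> < 1/2\<close> is the mirror image under \<open>k \<mapsto> n - 1 - k\<close>, which preserves the convex set.

  For \<open>\<theta> = 1/2\<close> the array \<open>n! * U n k\<close> is a bounded harmonic function of a Markov chain, in which
  \<open>k\<close> stays with probability \<open>(k + 1) / (n + 1)\<close> and else increases by one. Differences between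
  neighbouring columns satisfy a similar averaging relation of total weight only \<open>n / (n + 1)\<close>; as
  the product of these weights tends to \<open>0\<close>, bounded differences vanish, and \<open>n! * U n k\<close> is constant.
\<close>

section \<open>A criterion for extremality\<close>

text \<open>
  Unlike membership in the convex set, the bare recurrence is a linear condition, so it is inherited
  by differences of arrays. Entries outside the triangle are left unconstrained.
\<close>
definition eulerian_recurrence :: "(nat \<Rightarrow> nat \<Rightarrow> real) \<Rightarrow> bool" where
  "eulerian_recurrence E \<longleftrightarrow>
     (\<forall>n k. k < n \<longrightarrow> E n k = (real k + 1) * E (Suc n) k + (real n - real k) * E (Suc n) (Suc k))"

lemma eulerian_recurrenceD:
  "eulerian_recurrence E \<Longrightarrow> k < n \<Longrightarrow>
     E n k = (real k + 1) * E (Suc n) k + (real n - real k) * E (Suc n) (Suc k)"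
  unfolding eulerian_recurrence_def by blast

lemma eulerian_recurrence_diff_mult:
  assumes "eulerian_recurrence U" "eulerian_recurrence W"
  shows "eulerian_recurrence (\<lambda>n k. U n k - c * W n k)"
  unfolding eulerian_recurrence_def
proof (intro allI impI)
  fix n k :: nat
  assume kn: "k < n"
  show "U n k - c * W n k = (real k + 1) * (U (Suc n) k - c * W (Suc n) k)
      + (real n - real k) * (U (Suc n) (Suc k) - c * W (Suc n) (Suc k))"
    unfolding eulerian_recurrenceD[OF assms(1) kn] eulerian_recurrenceD[OF assms(2) kn]
    by (simp add: algebra_simps)
qed

lemma eulerian_arrays_iff:
  "V \<in> eulerian_arrays \<longleftrightarrow>
     (\<forall>n k. n \<le> k \<longrightarrow> V n k = 0) \<and> (\<forall>n k. k < n \<longrightarrow> 0 \<le> V n k) \<and> V 1 0 = 1 \<and>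
     eulerian_recurrence V"
proof -
  have inside: "1 \<le> n \<and> k < n \<longleftrightarrow> k < n" for n k :: nat
    by auto
  show ?thesis
    unfolding eulerian_arrays_def eulerian_recurrence_def mem_Collect_eq inside not_less
      Suc_eq_plus1 ..
qed

lemma eulerian_arrays_nonneg:
  "V \<in> eulerian_arrays \<Longrightarrow> 0 \<le> V n k"
  by (cases "k < n") (auto simp: eulerian_arrays_iff)

text \<open>
  If \<open>W = (1 - u) a + u b\<close> with \<open>0 < u < 1\<close>, then nonnegativity gives \<open>a \<le> W / (1 - u)\<close> and
  \<open>b \<le> W / u\<close>, so that \<open>a = W = b\<close> and the segment is degenerate.
\<close>
lemma extreme_arrays_if_dominated_unique:
  assumes W: "W \<in> eulerian_arrays"
    and unique: "\<And>U C. U \<in> eulerian_arrays \<Longrightarrow> (\<And>n k. U n k \<le> C * W n k) \<Longrightarrow> U = W"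
  shows "W \<in> extreme_arrays"
  unfolding extreme_arrays_def mem_Collect_eq extreme_point_of_def
proof (intro conjI ballI notI)
  show "W \<in> eulerian_arrays" by fact
next
  fix a b
  assume a: "a \<in> eulerian_arrays" and b: "b \<in> eulerian_arrays" and "W \<in> open_segment a b"
  then obtain u :: real
    where "a \<noteq> b" and u: "0 < u" "u < 1" and W_eq: "W = (1 - u) *\<^sub>R a + u *\<^sub>R b"
    by (auto simp: in_segment)
  have W_app: "W n k = (1 - u) * a n k + u * b n k" for n k
    unfolding W_eq by simp
  have "0 \<le> u * b n k" for n k
    using u eulerian_arrays_nonneg[OF b] by simp
  then have "a n k \<le> (1 / (1 - u)) * W n k" for n k
    using u unfolding W_app by (simp add: field_simps)
  then have "a = W"
    by (rule unique[OF a])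
  have "0 \<le> (1 - u) * a n k" for n k
    using u eulerian_arrays_nonneg[OF a] by simp
  then have "b n k \<le> (1 / u) * W n k" for n k
    using u unfolding W_app by (simp add: field_simps)
  then have "b = W"
    by (rule unique[OF b])
  with \<open>a = W\<close> \<open>a \<noteq> b\<close> show False
    by simp
qed

lemma W_array_eqI:
  assumes "inj_on (\<lambda>W. W 2 0) extreme_arrays" "W \<in> extreme_arrays" "W 2 0 = \<theta>"
  shows "W_array \<theta> = W"
  unfolding W_array_def using assms by (intro the_equality) (auto dest: inj_onD)


section \<open>Arrays with finitely many nonzero columns\<close>

text \<open>
  This is the Bayer--Diaconis formula: the probability that a \<open>(\<kappa> + 1)\<close>-shuffle of \<open>n\<close> cards produces
  a given permutation with \<open>k + 1\<close> rising sequences.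
\<close>
definition shuffle_array :: "nat \<Rightarrow> nat \<Rightarrow> nat \<Rightarrow> real" where
  "shuffle_array \<kappa> n k =
     (if k < n then real ((n + \<kappa> - k) choose n) / (real \<kappa> + 1) ^ n else 0)"

lemma Suc_times_binomial_Suc_real:
  "(real n + 1) * real (N choose Suc n) = (real N - real n) * real (N choose n)"
proof (cases "n \<le> N")
  case True
  have "Suc n * (N choose Suc n) = (N - n) * (N choose n)"
    using binomial_absorb_comp[of N n] binomial_absorption[of n N]
    by simp
  then have "real (Suc n * (N choose Suc n)) = real ((N - n) * (N choose n))"
    by simp
  then show ?thesis
    using True by (simp add: of_nat_diff algebra_simps)
qed (simp add: binomial_eq_0)

text \<open>
  With \<open>N = n + \<kappa> - k\<close>, both binomial coefficients on the right of the recurrence are multiples of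
  \<open>N choose n\<close>, and what remains is
  \<open>(k + 1) (N + 1) + (n - k) (N - n) = (\<kappa> + 1) (n + 1)\<close>.
\<close>
lemma eulerian_recurrence_shuffle_array: "eulerian_recurrence (shuffle_array \<kappa>)"
  unfolding eulerian_recurrence_def
proof (intro allI impI)
  fix n k :: nat
  assume kn: "k < n"
  define N where "N = n + \<kappa> - k"
  define b where "b = real (N choose n)"
  have N: "real N = real n + real \<kappa> - real k"
    using kn by (simp add: N_def of_nat_diff)
  have up: "(real n + 1) * real (N choose Suc n) = (real \<kappa> - real k) * b"
    using Suc_times_binomial_Suc_real[of n N] by (simp add: N b_def)
  have up_right: "(real n + 1) * real (Suc N choose Suc n) = (real N + 1) * b"
    using up by (simp add: N b_def algebra_simps)
  have "(real n + 1) * ((real k + 1) * real (Suc N choose Suc n)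
      + (real n - real k) * real (N choose Suc n))
    = (real k + 1) * ((real n + 1) * real (Suc N choose Suc n))
      + (real n - real k) * ((real n + 1) * real (N choose Suc n))"
    by (simp only: algebra_simps)
  also have "\<dots> = (real n + 1) * ((real \<kappa> + 1) * b)"
    unfolding up up_right N by (simp add: algebra_simps)
  finally have sum: "(real k + 1) * real (Suc N choose Suc n)
      + (real n - real k) * real (N choose Suc n) = (real \<kappa> + 1) * b"
    by (subst (asm) mult_cancel_left) auto
  have entries: "shuffle_array \<kappa> n k = b / (real \<kappa> + 1) ^ n"
    "shuffle_array \<kappa> (Suc n) k = real (Suc N choose Suc n) / (real \<kappa> + 1) ^ Suc n"
    "shuffle_array \<kappa> (Suc n) (Suc k) = real (N choose Suc n) / (real \<kappa> + 1) ^ Suc n"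
    using kn by (simp_all add: shuffle_array_def N_def b_def Suc_diff_le del: binomial_Suc_Suc)
  have "b / (real \<kappa> + 1) ^ n = ((real \<kappa> + 1) * b) / (real \<kappa> + 1) ^ Suc n"
    by (simp add: add_nonneg_eq_0_iff)
  then show "shuffle_array \<kappa> n k = (real k + 1) * shuffle_array \<kappa> (Suc n) k
      + (real n - real k) * shuffle_array \<kappa> (Suc n) (Suc k)"
    unfolding entries sum[symmetric] by (simp only: add_divide_distrib times_divide_eq_right)
qed

lemma shuffle_array_1_0: "shuffle_array \<kappa> 1 0 = 1"
  by (simp add: shuffle_array_def)

lemma shuffle_array_in_eulerian_arrays: "shuffle_array \<kappa> \<in> eulerian_arrays"
  unfolding eulerian_arrays_iff
  using eulerian_recurrence_shuffle_array shuffle_array_1_0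
  by (simp add: shuffle_array_def)

lemma shuffle_array_nonneg: "0 \<le> shuffle_array \<kappa> n k"
  by (simp add: shuffle_array_def)

lemma shuffle_array_2_0: "shuffle_array \<kappa> 2 0 = (real \<kappa> + 2) / (2 * (real \<kappa> + 1))"
proof -
  have "real ((2 + \<kappa>) choose 2) = (real \<kappa> + 2) * (real \<kappa> + 1) / 2"
    by (simp add: choose_two real_of_nat_div algebra_simps)
  moreover have "shuffle_array \<kappa> 2 0 = real ((2 + \<kappa>) choose 2) / (real \<kappa> + 1) ^ 2"
    by (simp add: shuffle_array_def)
  ultimately show ?thesis
    by (simp only: power2_eq_square) (simp add: divide_simps)
qed

lemma shuffle_array_column_eq_0: "\<kappa> < k \<Longrightarrow> shuffle_array \<kappa> n k = 0"
  by (auto simp: shuffle_array_def intro!: binomial_eq_0)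

text \<open>
  Column \<open>j\<close> grows at most polynomially in \<open>n\<close> after multiplication by \<open>(\<kappa> + 1) ^ n\<close>, because
  \<open>n + \<kappa> - j choose n\<close> is a polynomial of degree \<open>\<kappa> - j\<close> in \<open>n\<close>; hence it loses against any
  smaller base.
\<close>
lemma shuffle_array_column_decay:
  assumes "j < \<kappa>"
  shows "(\<lambda>n. (real j + 1) ^ n * shuffle_array \<kappa> n j) \<longlonglongrightarrow> 0"
proof (rule Lim_null_comparison)
  define e where "e = \<kappa> - j"
  define q where "q = (real j + 1) / (real \<kappa> + 1)"
  have q: "0 < q" "q < 1"
    using assms by (auto simp: q_def field_simps)
  show "(\<lambda>n. (real n + real e) ^ e * q ^ n) \<longlonglongrightarrow> 0"
    using q by real_asymp
  show "\<forall>\<^sub>F n in sequentially.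
      norm ((real j + 1) ^ n * shuffle_array \<kappa> n j) \<le> (real n + real e) ^ e * q ^ n"
  proof (rule eventually_mono[OF eventually_gt_at_top[of j]])
    fix n :: nat
    assume "j < n"
    have "(n + \<kappa> - j) choose n = (n + e) choose e"
      using assms binomial_symmetric[of n "n + e"] by (simp add: e_def)
    also have "\<dots> \<le> (n + e) ^ e"
      by (rule binomial_le_pow) simp
    finally have "real ((n + \<kappa> - j) choose n) \<le> (real n + real e) ^ e"
      by (metis of_nat_add of_nat_le_iff of_nat_power)
    moreover have "norm ((real j + 1) ^ n * shuffle_array \<kappa> n j)
        = real ((n + \<kappa> - j) choose n) * q ^ n"
      using \<open>j < n\<close> by (simp add: shuffle_array_def q_def power_divide abs_mult)
    ultimately show "norm ((real j + 1) ^ n * shuffle_array \<kappa> n j)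
        \<le> (real n + real e) ^ e * q ^ n"
      using q by (simp add: mult_right_mono)
  qed
qed

text \<open>
  The induction goes from column \<open>\<kappa>\<close> down to column \<open>0\<close>: if the next column vanishes, then
  \<open>(j + 1) ^ n * E n j\<close> is independent of \<open>n\<close>, while by the domination it tends to \<open>0\<close>.
\<close>
lemma eulerian_recurrence_eq_0_if_dominated:
  assumes rec: "eulerian_recurrence E"
    and dom: "\<And>n k. \<bar>E n k\<bar> \<le> C * shuffle_array \<kappa> n k"
    and column: "\<And>n. \<kappa> < n \<Longrightarrow> E n \<kappa> = 0"
  shows "E n k = 0"
proof -
  have below: "E n j = 0" if "j \<le> \<kappa>" "j < n" for n j
    using that
  proof (induction "\<kappa> - j" arbitrary: j n)
    case 0
    then show ?case
      using column by simp
  next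
    case (Suc d)
    then have j: "j < \<kappa>"
      by simp
    have next_column: "E m (Suc j) = 0" if "Suc j < m" for m
      using Suc.hyps(1)[of "Suc j" m] Suc.hyps(2) j that by simp
    have geometric: "E m j = (real j + 1) * E (Suc m) j" if "j < m" for m
      using eulerian_recurrenceD[OF rec that] next_column[of "Suc m"] that by simp
    have const: "(real j + 1) ^ n * E n j = (real j + 1) ^ m * E m j" if "n \<le> m" for m
      using that
    proof (induction m rule: dec_induct)
      case (step m)
      then show ?case
        using Suc.prems(2) geometric[of m]
        by (simp add: mult.assoc mult.left_commute)
    qed simp
    have "(\<lambda>m. C * ((real j + 1) ^ m * shuffle_array \<kappa> m j)) \<longlonglongrightarrow> 0"
      using tendsto_mult_right_zero[OF shuffle_array_column_decay[OF j]] .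
    moreover have "\<forall>\<^sub>F m in sequentially. norm ((real j + 1) ^ n * E n j)
        \<le> C * ((real j + 1) ^ m * shuffle_array \<kappa> m j)"
    proof (rule eventually_mono[OF eventually_ge_at_top[of n]])
      fix m :: nat
      assume "n \<le> m"
      then have "norm ((real j + 1) ^ n * E n j) = (real j + 1) ^ m * \<bar>E m j\<bar>"
        using const by (simp add: abs_mult)
      also have "\<dots> \<le> (real j + 1) ^ m * (C * shuffle_array \<kappa> m j)"
        by (intro mult_left_mono dom) simp
      finally show "norm ((real j + 1) ^ n * E n j)
          \<le> C * ((real j + 1) ^ m * shuffle_array \<kappa> m j)"
        by (simp only: mult.left_commute)
    qed
    ultimately have "norm ((real j + 1) ^ n * E n j) \<le> 0"
      by (intro tendsto_lowerbound) auto
    then show ?case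
      by (simp add: add_nonneg_eq_0_iff)
  qed
  have "E n k = 0" if "\<kappa> < k \<or> n \<le> k"
  proof -
    have "shuffle_array \<kappa> n k = 0"
      using that shuffle_array_column_eq_0 by (auto simp: shuffle_array_def)
    then show ?thesis
      using dom[of n k] by simp
  qed
  with below show ?thesis
    by (meson not_less)
qed

lemma shuffle_array_extreme: "shuffle_array \<kappa> \<in> extreme_arrays"
proof (rule extreme_arrays_if_dominated_unique[OF shuffle_array_in_eulerian_arrays])
  fix U C
  assume U: "U \<in> eulerian_arrays" and dom: "\<And>n k. U n k \<le> C * shuffle_array \<kappa> n k"
  \<comment> \<open>Row \<open>\<kappa> + 1\<close> is the first that meets column \<open>\<kappa>\<close>, and there
    \<open>shuffle_array \<kappa>\<close> takes the value \<open>(\<kappa> + 1) ^ (- \<kappa> - 1)\<close>.\<close>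
  define c where "c = U (Suc \<kappa>) \<kappa> * (real \<kappa> + 1) ^ Suc \<kappa>"
  define E where "E = (\<lambda>n k. U n k - c * shuffle_array \<kappa> n k)"
  have rec: "eulerian_recurrence E"
    unfolding E_def using U eulerian_recurrence_shuffle_array
    by (intro eulerian_recurrence_diff_mult) (auto simp: eulerian_arrays_iff)
  have E_dom: "\<bar>E n k\<bar> \<le> (C + \<bar>c\<bar>) * shuffle_array \<kappa> n k" for n k
  proof -
    have "\<bar>E n k\<bar> \<le> \<bar>U n k\<bar> + \<bar>c * shuffle_array \<kappa> n k\<bar>"
      unfolding E_def by (rule abs_triangle_ineq4)
    also have "\<dots> = U n k + \<bar>c\<bar> * shuffle_array \<kappa> n k"
      using eulerian_arrays_nonneg[OF U] shuffle_array_nonneg by (simp add: abs_mult)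
    finally show ?thesis
      using dom[of n k] by (simp add: distrib_right)
  qed
  have column: "E n \<kappa> = 0" if "\<kappa> < n" for n
    using Suc_leI[OF that]
  proof (induction n rule: dec_induct)
    case base
    show ?case
      by (simp add: E_def c_def shuffle_array_def)
  next
    case (step n)
    have "E (Suc n) (Suc \<kappa>) = 0"
      using E_dom[of "Suc n" "Suc \<kappa>"] shuffle_array_column_eq_0[of \<kappa> "Suc \<kappa>"] by simp
    then show ?case
      using eulerian_recurrenceD[OF rec, of \<kappa> n] step by (simp add: add_nonneg_eq_0_iff)
  qed
  have E_0: "E n k = 0" for n k
    by (rule eulerian_recurrence_eq_0_if_dominated[OF rec E_dom column])
  have "c = 1"
    using E_0[of 1 0] U by (simp add: E_def shuffle_array_1_0[simplified] eulerian_arrays_iff)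
  then show "U = shuffle_array \<kappa>"
    using E_0 by (simp add: E_def fun_eq_iff)
qed


section \<open>Reflection\<close>

definition reflect :: "(nat \<Rightarrow> nat \<Rightarrow> real) \<Rightarrow> nat \<Rightarrow> nat \<Rightarrow> real" where
  "reflect V n k = (if k < n then V n (n - 1 - k) else 0)"

lemma reflect_in_eulerian_arrays:
  assumes "V \<in> eulerian_arrays"
  shows "reflect V \<in> eulerian_arrays"
  unfolding eulerian_arrays_iff
proof (intro conjI allI impI)
  show "reflect V 1 0 = 1"
    using assms by (simp add: reflect_def eulerian_arrays_iff)
  show "eulerian_recurrence (reflect V)"
    unfolding eulerian_recurrence_def
  proof (intro allI impI)
    fix n k :: nat
    assume kn: "k < n"
    have "eulerian_recurrence V"
      using assms by (simp add: eulerian_arrays_iff)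
    from eulerian_recurrenceD[OF this, of "n - 1 - k" n] kn
    show "reflect V n k = (real k + 1) * reflect V (Suc n) k
        + (real n - real k) * reflect V (Suc n) (Suc k)"
      by (simp add: reflect_def of_nat_diff Suc_diff_Suc algebra_simps)
  qed
qed (simp_all add: reflect_def eulerian_arrays_nonneg[OF assms])

lemma reflect_reflect: "V \<in> eulerian_arrays \<Longrightarrow> reflect (reflect V) = V"
  by (auto simp: reflect_def fun_eq_iff eulerian_arrays_iff)

lemma reflect_in_extreme_arrays:
  assumes "W \<in> extreme_arrays"
  shows "reflect W \<in> extreme_arrays"
proof -
  have W: "W \<in> eulerian_arrays"
    and ext: "\<And>a b. a \<in> eulerian_arrays \<Longrightarrow> b \<in> eulerian_arrays \<Longrightarrow> W \<notin> open_segment a b"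
    using assms by (auto simp: extreme_arrays_def extreme_point_of_def)
  have "reflect W \<notin> open_segment a b" if a: "a \<in> eulerian_arrays" and b: "b \<in> eulerian_arrays" for a b
  proof
    assume "reflect W \<in> open_segment a b"
    then obtain u :: real
      where "a \<noteq> b" and u: "0 < u" "u < 1" and eq: "reflect W = (1 - u) *\<^sub>R a + u *\<^sub>R b"
      by (auto simp: in_segment)
    have "W = reflect ((1 - u) *\<^sub>R a + u *\<^sub>R b)"
      using reflect_reflect[OF W] by (simp add: eq)
    also have "\<dots> = (1 - u) *\<^sub>R reflect a + u *\<^sub>R reflect b"
      by (simp add: reflect_def fun_eq_iff)
    finally have "W = (1 - u) *\<^sub>R reflect a + u *\<^sub>R reflect b" .
    moreover have "reflect a \<noteq> reflect b"
      using \<open>a \<noteq> b\<close> reflect_reflect[OF a] reflect_reflect[OF b] by metis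
    ultimately have "W \<in> open_segment (reflect a) (reflect b)"
      using u by (auto simp: in_segment)
    then show False
      using ext a b reflect_in_eulerian_arrays by blast
  qed
  then show ?thesis
    using reflect_in_eulerian_arrays[OF W] by (simp add: extreme_arrays_def extreme_point_of_def)
qed

lemma reflect_shuffle_array:
  assumes "k < n"
  shows "reflect (shuffle_array \<kappa>) n k = real ((\<kappa> + k + 1) choose n) / (real \<kappa> + 1) ^ n"
proof -
  have "n + \<kappa> - (n - 1 - k) = \<kappa> + k + 1"
    using assms by simp
  then show ?thesis
    using assms by (simp add: reflect_def shuffle_array_def)
qed

lemma reflect_shuffle_array_2_0:
  "reflect (shuffle_array \<kappa>) 2 0 = real \<kappa> / (2 * (real \<kappa> + 1))"
proof -
  have "real (Suc \<kappa> choose 2) = (real \<kappa> + 1) * real \<kappa> / 2"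
    by (simp add: choose_two real_of_nat_div algebra_simps)
  moreover have "reflect (shuffle_array \<kappa>) 2 0 = real (Suc \<kappa> choose 2) / (real \<kappa> + 1) ^ 2"
    by (subst reflect_shuffle_array) simp_all
  ultimately show ?thesis
    by (simp only: power2_eq_square) (simp add: divide_simps)
qed


section \<open>The array whose rows are constant\<close>

definition uniform_array :: "nat \<Rightarrow> nat \<Rightarrow> real" where
  "uniform_array n k = (if k < n then 1 / fact n else 0)"

lemma uniform_array_in_eulerian_arrays: "uniform_array \<in> eulerian_arrays"
proof -
  have "1 / fact n = (real k + 1) * (1 / fact (Suc n)) + (real n - real k) * (1 / fact (Suc n))"
    for n k
    by (simp add: distrib_right[symmetric] del: times_divide_eq_right)
      (simp add: add_nonneg_eq_0_iff)
  then have "eulerian_recurrence uniform_array"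
    by (simp add: eulerian_recurrence_def uniform_array_def)
  then show ?thesis
    by (simp add: eulerian_arrays_iff uniform_array_def)
qed

text \<open>
  Subtracting the averaging relations of two neighbouring columns leaves nonnegative weights
  \<open>k + 1\<close> and \<open>n - k - 1\<close>, of sum \<open>n\<close>, against the denominator \<open>n + 1\<close>. Over \<open>m\<close> rows the bound
  on the differences therefore improves by the telescoping factor
  \<open>n / (n + 1) * \<dots> * (n + m - 1) / (n + m) = n / (n + m)\<close>.
\<close>
lemma bounded_harmonic_difference_bound:
  fixes f :: "nat \<Rightarrow> nat \<Rightarrow> real"
  assumes harmonic: "\<And>n k. k < n \<Longrightarrow>
      (real n + 1) * f n k = (real k + 1) * f (Suc n) k + (real n - real k) * f (Suc n) (Suc k)"
    and bounded: "\<And>n k. \<bar>f n (Suc k) - f n k\<bar> \<le> C"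
    and "Suc k < n"
  shows "\<bar>f n (Suc k) - f n k\<bar> \<le> real n / (real n + real m) * C"
  using \<open>Suc k < n\<close>
proof (induction m arbitrary: n k)
  case 0
  then show ?case
    using bounded[of n k] by simp
next
  case (Suc m)
  define B where "B = real (Suc n) / (real (Suc n) + real m) * C"
  define g where "g = (\<lambda>i. f (Suc n) (Suc i) - f (Suc n) i)"
  have g: "\<bar>g k\<bar> \<le> B" "\<bar>g (Suc k)\<bar> \<le> B"
    using Suc.IH[of k "Suc n"] Suc.IH[of "Suc k" "Suc n"] Suc.prems by (simp_all add: B_def g_def)
  have "(real n + 1) * (f n (Suc k) - f n k)
      = (real k + 1) * g k + (real n - real k - 1) * g (Suc k)"
    using harmonic[of k n] harmonic[of "Suc k" n] Suc.prems by (simp add: g_def algebra_simps)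
  then have "(real n + 1) * \<bar>f n (Suc k) - f n k\<bar>
      = \<bar>(real k + 1) * g k + (real n - real k - 1) * g (Suc k)\<bar>"
    by (metis abs_mult abs_of_nonneg of_nat_0_le_iff of_nat_Suc add.commute)
  also have "\<dots> \<le> \<bar>(real k + 1) * g k\<bar> + \<bar>(real n - real k - 1) * g (Suc k)\<bar>"
    by (rule abs_triangle_ineq)
  also have "\<dots> = (real k + 1) * \<bar>g k\<bar> + (real n - real k - 1) * \<bar>g (Suc k)\<bar>"
    using Suc.prems by (simp add: abs_mult)
  also have "\<dots> \<le> (real k + 1) * B + (real n - real k - 1) * B"
    using g Suc.prems by (intro add_mono mult_left_mono) auto
  also have "\<dots> = real n * B"
    by (simp add: algebra_simps)
  finally have "\<bar>f n (Suc k) - f n k\<bar> \<le> real n * B / (real n + 1)"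
    by (simp add: field_simps)
  also have "\<dots> = real n / (real n + real (Suc m)) * C"
    by (simp add: B_def divide_simps) (simp add: algebra_simps)
  finally show ?case .
qed

lemma uniform_array_extreme: "uniform_array \<in> extreme_arrays"
proof (rule extreme_arrays_if_dominated_unique[OF uniform_array_in_eulerian_arrays])
  fix U C
  assume U: "U \<in> eulerian_arrays" and dom: "\<And>n k. U n k \<le> C * uniform_array n k"
  have rec: "U n k = (real k + 1) * U (Suc n) k + (real n - real k) * U (Suc n) (Suc k)"
    if "k < n" for n k
    using U that by (intro eulerian_recurrenceD) (simp_all add: eulerian_arrays_iff)
  define f where "f = (\<lambda>n k. fact n * U n k)"
  have harmonic: "(real n + 1) * f n k
      = (real k + 1) * f (Suc n) k + (real n - real k) * f (Suc n) (Suc k)" if "k < n" for n k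
    unfolding f_def rec[OF that] by (simp add: algebra_simps)
  have "C \<ge> 1"
    using dom[of 1 0] U by (simp add: uniform_array_def eulerian_arrays_iff)
  have f_bounds: "0 \<le> f n k" "f n k \<le> C" for n k
    using dom[of n k] eulerian_arrays_nonneg[OF U, of n k] \<open>C \<ge> 1\<close>
    by (auto simp: f_def uniform_array_def field_simps split: if_splits)
  have bounded: "\<bar>f n (Suc k) - f n k\<bar> \<le> C" for n k
    using f_bounds[of n k] f_bounds[of n "Suc k"] by linarith
  have neighbours: "f n (Suc k) = f n k" if "Suc k < n" for n k
  proof -
    have "(\<lambda>m. real n / (real n + real m) * C) \<longlonglongrightarrow> 0"
      by real_asymp
    moreover have "\<forall>\<^sub>F m in sequentially.
        \<bar>f n (Suc k) - f n k\<bar> \<le> real n / (real n + real m) * C"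
      using bounded_harmonic_difference_bound[OF harmonic bounded that] by simp
    ultimately have "\<bar>f n (Suc k) - f n k\<bar> \<le> 0"
      by (intro tendsto_lowerbound) auto
    then show ?thesis
      by simp
  qed
  have row: "f n k = f n 0" if "k < n" for n k
    using that by (induction k) (auto simp: neighbours)
  have f_1: "f (Suc n) 0 = 1" for n
  proof (induction n)
    case 0
    then show ?case
      using U by (simp add: f_def eulerian_arrays_iff)
  next
    case (Suc n)
    have "(real (Suc n) + 1) * f (Suc n) 0 = (real (Suc n) + 1) * f (Suc (Suc n)) 0"
      using harmonic[of 0 "Suc n"] row[of 1 "Suc (Suc n)"] by (simp add: algebra_simps)
    with Suc show ?case
      by simp
  qed
  have "U n k = uniform_array n k" for n k
  proof (cases "k < n")
    case True
    then have "f n k = 1"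
      using row[of k n] f_1[of "n - 1"] by simp
    then show ?thesis
      using True by (simp add: f_def uniform_array_def field_simps)
  next
    case False
    then show ?thesis
      using U by (simp add: uniform_array_def eulerian_arrays_iff)
  qed
  then show "U = uniform_array"
    by (simp add: fun_eq_iff)
qed


section \<open>The extreme points\<close>

theorem theorem2:
  fixes n k :: nat
  assumes "bij_betw (\<lambda>W. W 2 0) extreme_arrays Theta"
    and "1 \<le> n" and "k \<le> n - 1"
  shows "(\<forall>\<kappa>::nat. \<forall>\<theta>::real. \<theta> = (real \<kappa> + 2) / (2 * (real \<kappa> + 1)) \<longrightarrow>
            W_array \<theta> n k = real ((n + \<kappa> - k) choose n) / (real \<kappa> + 1) ^ n) \<and>
         (\<forall>\<kappa>::nat. \<forall>\<theta>::real. \<theta> = real \<kappa> / (2 * (real \<kappa> + 1)) \<longrightarrow>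
            W_array \<theta> n k = real ((\<kappa> + k + 1) choose n) / (real \<kappa> + 1) ^ n) \<and>
         W_array (1 / 2) n k = 1 / fact n"
proof -
  have kn: "k < n"
    using assms(2,3) by simp
  note W_eqI = W_array_eqI[OF bij_betw_imp_inj_on[OF assms(1)]]
  have "W_array ((real \<kappa> + 2) / (2 * (real \<kappa> + 1))) = shuffle_array \<kappa>" for \<kappa>
    by (intro W_eqI shuffle_array_extreme shuffle_array_2_0)
  moreover have "W_array (real \<kappa> / (2 * (real \<kappa> + 1))) = reflect (shuffle_array \<kappa>)" for \<kappa>
    by (intro W_eqI reflect_in_extreme_arrays shuffle_array_extreme reflect_shuffle_array_2_0)
  moreover have "W_array (1 / 2) = uniform_array"
    by (intro W_eqI uniform_array_extreme) (simp add: uniform_array_def)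
  ultimately show ?thesis
    using kn by (simp add: reflect_shuffle_array) (simp add: shuffle_array_def uniform_array_def)
qed

end
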